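(* Let $\mathcal{H}$ be a helix in $\mathbb{R}^3$ of curvature $\kappa>0$ and torsion $\tau>0$ with $\tau\kappa^{1/3}\ge 0.4(\kappa^2+\tau^2)$. Let $A_0,A_1,A_2$ be three distinct lattice points (points of $\mathbb{Z}^3$) on $\mathcal{H}$. Then the maximal distance between $A_0$, $A_1$ and $A_2$, i.e. $\max(|A_0A_1|,|A_1A_2|,|A_0A_2|)$, is at least $1.1\,\kappa^{-1/3}$.
   Context: A helix is a curve in $\mathbb{R}^3$ with constant curvature $\kappa$ and constant torsion $\tau$. Sign convention for torsion: for $a,b>0$ the helix $\vec r(t)=\langle a\cos t,a\sin t,bt\rangle$ has curvature $\kappa=\frac{a}{a^2+b^2}$ and torsion $\tau=\frac{b}{a^2+b^2}$; every helix with curvature $\kappa>0$ and torsion $\tau>0$ is the image under an orientation-preserving rigid motion of this one with $a=\frac{\kappa}{\kappa^2+\tau^2}$, $b=\frac{\tau}{\kappa^2+\tau^2}$. $|AB|$ is the Euclidean distance between $A$ and $B$. *)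

theory Defs
  imports "HOL-Analysis.Analysis"
begin

definition curve_deriv :: "real set \<Rightarrow> (real \<Rightarrow> real^3) \<Rightarrow> real \<Rightarrow> real^3" where
  "curve_deriv I r t = vector_derivative r (at t within I)"

text \<open>Derivatives are taken within \<open>I\<close>, hence are one-sided at endpoints belonging to \<open>I\<close>;
  they are unique because \<open>I\<close> is non-degenerate.\<close>

definition regular_C3_curve :: "real set \<Rightarrow> (real \<Rightarrow> real^3) \<Rightarrow> bool" where
  "regular_C3_curve I r \<longleftrightarrow>
     is_interval I \<and> (\<exists>s\<in>I. \<exists>t\<in>I. s < t) \<and>
     r differentiable_on I \<and>
     curve_deriv I r differentiable_on I \<and>
     (curve_deriv I ^^ 2) r differentiable_on I \<and>
     continuous_on I ((curve_deriv I ^^ 3) r) \<and>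
     (\<forall>t\<in>I. curve_deriv I r t \<noteq> 0)"

text \<open>Curvature and torsion of a regular curve in an arbitrary (not necessarily arc-length)
  parametrization.\<close>

definition curvature :: "real set \<Rightarrow> (real \<Rightarrow> real^3) \<Rightarrow> real \<Rightarrow> real" where
  "curvature I r t =
     norm (cross3 (curve_deriv I r t) ((curve_deriv I ^^ 2) r t)) / norm (curve_deriv I r t) ^ 3"

definition torsion :: "real set \<Rightarrow> (real \<Rightarrow> real^3) \<Rightarrow> real \<Rightarrow> real" where
  "torsion I r t =
     (cross3 (curve_deriv I r t) ((curve_deriv I ^^ 2) r t) \<bullet> (curve_deriv I ^^ 3) r t) /
     norm (cross3 (curve_deriv I r t) ((curve_deriv I ^^ 2) r t)) ^ 2"

text \<open>A helix is a point set. The parameter interval is arbitrary, so complete helices as well as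
  arcs of them are included. Only meant for \<open>\<kappa> > 0\<close>: torsion is undefined where the curvature
  vanishes.\<close>

definition is_helix :: "real \<Rightarrow> real \<Rightarrow> (real^3) set \<Rightarrow> bool" where
  "is_helix \<kappa> \<tau> H \<longleftrightarrow>
     (\<exists>I r. regular_C3_curve I r \<and> H = r ` I \<and>
        (\<forall>t\<in>I. curvature I r t = \<kappa> \<and> torsion I r t = \<tau>))"

definition lattice_point :: "real^3 \<Rightarrow> bool" where
  "lattice_point A \<longleftrightarrow> (\<forall>i. A $ i \<in> \<int>)"

text \<open>The sign convention for torsion: the right-handed circular helix has positive torsion.\<close>

lemma is_helix_circular:
  fixes a b :: real
  assumes "a > 0" "b > 0"
  shows "is_helix (a / (a\<^sup>2 + b\<^sup>2)) (b / (a\<^sup>2 + b\<^sup>2))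
    (range (\<lambda>t. vector [a * cos t, a * sin t, b * t]))"
proof -
  define r :: "real \<Rightarrow> real^3" where "r = (\<lambda>t. vector [a * cos t, a * sin t, b * t])"
  have expand: "vector [x, y, z] = x *\<^sub>R axis 1 1 + y *\<^sub>R axis 2 1 + z *\<^sub>R (axis 3 1 :: real^3)"
    for x y z :: real
    by (simp add: vec_eq_iff forall_3 axis_def)
  let ?r1 = "\<lambda>t. vector [- a * sin t, a * cos t, b] :: real^3"
  let ?r2 = "\<lambda>t. vector [- a * cos t, - a * sin t, 0] :: real^3"
  let ?r3 = "\<lambda>t. vector [a * sin t, - a * cos t, 0] :: real^3"
  let ?r4 = "\<lambda>t. vector [a * cos t, a * sin t, 0] :: real^3"
  have d0: "(r has_vector_derivative ?r1 t) (at t)" for t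
    unfolding r_def expand by (auto intro!: derivative_eq_intros simp: mult.commute)
  have d1: "(?r1 has_vector_derivative ?r2 t) (at t)" for t
    unfolding expand by (auto intro!: derivative_eq_intros simp: mult.commute)
  have d2: "(?r2 has_vector_derivative ?r3 t) (at t)" for t
    unfolding expand by (auto intro!: derivative_eq_intros simp: mult.commute)
  have d3: "(?r3 has_vector_derivative ?r4 t) (at t)" for t
    unfolding expand by (auto intro!: derivative_eq_intros simp: mult.commute)
  have c1: "curve_deriv UNIV r = ?r1"
    unfolding curve_deriv_def fun_eq_iff using d0 vector_derivative_at by blast
  have "curve_deriv UNIV ?r1 = ?r2"
    unfolding curve_deriv_def fun_eq_iff using d1 vector_derivative_at by blast
  then have c2: "(curve_deriv UNIV ^^ 2) r = ?r2" by (simp add: c1 eval_nat_numeral)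
  have "curve_deriv UNIV ?r2 = ?r3"
    unfolding curve_deriv_def fun_eq_iff using d2 vector_derivative_at by blast
  then have c3: "(curve_deriv UNIV ^^ 3) r = ?r3"
    using c2 by (simp add: eval_nat_numeral)
  have diff: "f differentiable_on UNIV"
    if "\<And>t. (f has_vector_derivative g t) (at t)" for f g :: "real \<Rightarrow> real^3"
    using that by (auto simp: differentiable_on_def intro: differentiableI_vector)
  have regular: "regular_C3_curve UNIV r"
    unfolding regular_C3_curve_def c1 c2 c3
  proof (intro conjI ballI)
    show "\<exists>s\<in>UNIV. \<exists>t\<in>UNIV. s < (t::real)" using zero_less_one by blast
    show "?r1 t \<noteq> 0" for t using \<open>b > 0\<close> by (simp add: vec_eq_iff forall_3)
  qed (use diff [OF d0] diff [OF d1] diff [OF d2] differentiable_imp_continuous_on [OF diff [OF d3]] in auto)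
  define s where "s = sqrt (a\<^sup>2 + b\<^sup>2)"
  have s: "s > 0" "a\<^sup>2 + b\<^sup>2 = s\<^sup>2"
    using assms by (auto simp: s_def intro: add_pos_pos)
  have cs: "(cos t)\<^sup>2 = 1 - (sin t)\<^sup>2" for t :: real by (simp add: cos_squared_eq)
  have cross: "cross3 (?r1 t) (?r2 t) = vector [a * b * sin t, - a * b * cos t, a\<^sup>2]" for t
    by (simp add: vec_eq_iff forall_3 cross3_def power2_eq_square [of "sin t"]
        power2_eq_square [of a] algebra_simps)
      (metis cs power2_eq_square distrib_left mult.right_neutral sin_cos_squared_add2)
  have n1: "norm (?r1 t) = s" for t
    unfolding norm_eq_sqrt_inner s_def
    by (simp add: inner_vec_def sum_3 power2_eq_square [symmetric] power_mult_distrib cs algebra_simps)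
  have "(norm (cross3 (?r1 t) (?r2 t)))\<^sup>2 = (a * s)\<^sup>2" for t
    unfolding power2_norm_eq_inner cross
    by (simp add: inner_vec_def sum_3 power_mult_distrib s(2) [symmetric])
      (simp add: power2_eq_square [symmetric] power_mult_distrib cs algebra_simps)
  then have n2: "norm (cross3 (?r1 t) (?r2 t)) = a * s" for t
    using s assms by (simp add: power2_eq_iff_nonneg)
  have n3: "cross3 (?r1 t) (?r2 t) \<bullet> ?r3 t = a\<^sup>2 * b" for t
    unfolding cross
    by (simp add: inner_vec_def sum_3)
      (simp add: power2_eq_square [symmetric] power_mult_distrib cs algebra_simps)
  have "curvature UNIV r t = a / (a\<^sup>2 + b\<^sup>2)" "torsion UNIV r t = b / (a\<^sup>2 + b\<^sup>2)" for t
    unfolding curvature_def torsion_def c1 c2 c3 n1 n2 n3 s(2)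
    using assms s by (auto simp: field_simps eval_nat_numeral)
  with regular show ?thesis
    unfolding is_helix_def r_def by blast
qed

end

theory Submission
  imports Defs
begin

text \<open>
  Three lattice points that are not collinear span a parallelogram of area at least \<open>1\<close>, because
  the cross product of two edges is a nonzero integer vector. The theorem holds because three
  points of the helix that are too close to each other are not collinear, yet span a parallelogram
  of area less than \<open>1\<close>.

  Let the points be \<open>r a\<close>, \<open>r c\<close>, \<open>r b\<close> in the order in which the helix visits them, let \<open>d\<close> be the
  distance of the outer two, \<open>l\<close> the arc length between these, and \<open>\<omega> = sqrt (\<kappa>\<^sup>2 + \<tau>\<^sup>2)\<close>. Suppose
  that \<open>d < 1.1 * \<kappa> powr (-1/3)\<close>.

  \<^item> The Darboux vector \<open>\<tau> T + \<kappa> B\<close> is constant, of length \<open>\<omega>\<close>, and its inner product with the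
    tangent is \<open>\<tau>\<close>; so \<open>\<tau> l \<le> \<omega> d\<close> (\<open>len_le_chord_axis\<close>). The hypothesis on curvature and torsion
    turns this into \<open>\<omega> l < 2.75\<close>: the arc is less than half a turn.
  \<^item> On such a short arc the tangent stays close to the tangent at the midpoint, whence
    \<open>l \<le> 3/2 * d\<close> (\<open>chord_ge\<close>).
  \<^item> The second derivative by arc length has norm \<open>\<kappa>\<close>, so the error of linear interpolation puts
    \<open>r c\<close> within \<open>\<kappa> l\<^sup>2 / 8\<close> of the chord (\<open>dist_chord_point_le\<close>). The area is therefore at
    most \<open>\<kappa> l\<^sup>2 d / 8 \<le> 9/32 * \<kappa> d ^ 3 < 9/32 * 1.1 ^ 3 < 1\<close>.
  \<^item> On such a short arc the principal normal keeps a positive inner product with the normal at the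
    midpoint, so the deviation from the chord is strictly convex in that direction; this excludes
    collinear points (\<open>cross_nonzero\<close>).

  All of this rests on the Frenet equations alone, which replace the classification of helices up
  to rigid motions. They are derived for an arbitrary regular parametrization (\<open>frenet_frame\<close>), in
  which arc length is a function \<open>s\<close> of the parameter whose derivative is the speed \<open>v\<close>.
\<close>

section \<open>Lattice triangles\<close>

lemma norm_cross_lattice_ge_1:
  fixes A B C :: "real^3"
  assumes "lattice_point A" "lattice_point B" "lattice_point C"
    and nz: "cross3 (B - A) (C - A) \<noteq> 0"
  shows "norm (cross3 (B - A) (C - A)) \<ge> 1"
proof -
  define p where "p = cross3 (B - A) (C - A)"
  have comp: "p $ i \<in> \<int>" for i
    using assms(1-3) exhaust_3 [of i] unfolding p_def lattice_point_def
    by (auto simp: cross3_def intro!: Ints_diff Ints_mult)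
  have "p \<bullet> p \<in> \<int>"
    unfolding inner_vec_def using comp by (auto intro!: Ints_sum Ints_mult)
  moreover have "p \<bullet> p > 0"
    using nz by (simp add: p_def)
  ultimately have "p \<bullet> p \<ge> 1"
    by (metis Ints_cases of_int_0_less_iff of_int_1_le_iff int_one_le_iff_zero_less)
  then show ?thesis
    by (simp add: p_def norm_eq_sqrt_inner)
qed

section \<open>Calculus with respect to a weight\<close>

lemma mean_value_within:
  fixes f :: "real \<Rightarrow> real"
  assumes deriv: "\<And>t. t \<in> {a..b} \<Longrightarrow> (f has_real_derivative f' t) (at t within {a..b})"
    and "a \<le> x" "x < y" "y \<le> b"
  obtains z where "x < z" "z < y" "f y - f x = f' z * (y - x)"
proof -
  have "(f has_derivative (*) (f' t)) (at t within {x..y})" if "x \<le> t" "t \<le> y" for t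
    using deriv [of t] that assms(2-4) unfolding has_field_derivative_def
    by (auto intro: has_derivative_subset)
  from mvt_simple [OF \<open>x < y\<close> this] show ?thesis
    using that by auto
qed

lemma nondecreasing_within:
  fixes f :: "real \<Rightarrow> real"
  assumes deriv: "\<And>t. t \<in> {a..b} \<Longrightarrow> (f has_real_derivative f' t) (at t within {a..b})"
    and nonneg: "\<And>t. t \<in> {a..b} \<Longrightarrow> f' t \<ge> 0"
    and "a \<le> x" "x \<le> y" "y \<le> b"
  shows "f x \<le> f y"
proof (cases "x = y")
  case False
  with assms obtain z where z: "x < z" "z < y" "f y - f x = f' z * (y - x)"
    using mean_value_within [OF deriv, of x y] by auto
  have "f' z \<ge> 0"
    using nonneg z assms by auto
  then have "f' z * (y - x) \<ge> 0"
    using z by simp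
  then show ?thesis
    using z by linarith
qed auto

text \<open>If \<open>v\<close> is the speed of a curve, \<open>v * q\<close> is the derivative of \<open>f\<close> in the parameter and
  \<open>q\<close> its derivative with respect to arc length; a monotone \<open>q\<close> thus says that \<open>f\<close> is
  convex as a function of arc length, and a convex function lies below its chord.
  Arguing with the mean value theorem in the given parameter avoids reparametrizing.\<close>

lemma convex_wrt_weight:
  fixes f q v :: "real \<Rightarrow> real"
  assumes deriv: "\<And>t. t \<in> {a..b} \<Longrightarrow> (f has_real_derivative v t * q t) (at t within {a..b})"
    and v: "\<And>t. t \<in> {a..b} \<Longrightarrow> v t > 0"
    and f: "f a = 0" "f b = 0"
    and c: "a < c" "c < b"
  shows convex_wrt_weight_nonpos: "(\<And>x y. a \<le> x \<Longrightarrow> x < y \<Longrightarrow> y \<le> b \<Longrightarrow> q x \<le> q y) \<Longrightarrow> f c \<le> 0"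
    and convex_wrt_weight_nonzero: "(\<And>x y. a \<le> x \<Longrightarrow> x < y \<Longrightarrow> y \<le> b \<Longrightarrow> q x < q y) \<Longrightarrow> f c \<noteq> 0"
proof -
  obtain x where x: "a < x" "x < c" "f c - f a = v x * q x * (c - a)"
    using mean_value_within [OF deriv, of a c] c by auto
  obtain y where y: "c < y" "y < b" "f b - f c = v y * q y * (b - c)"
    using mean_value_within [OF deriv, of c b] c by auto
  have vx: "v x > 0" and vy: "v y > 0"
    using v x y c by auto
  show "f c \<le> 0" if mono: "\<And>x y. a \<le> x \<Longrightarrow> x < y \<Longrightarrow> y \<le> b \<Longrightarrow> q x \<le> q y"
  proof (rule ccontr)
    assume "\<not> f c \<le> 0"
    then have "0 < v x * q x * (c - a)" "v y * q y * (b - c) < 0"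
      using x y f by auto
    then have "0 < q x" "q y < 0"
      using vx vy c by (auto simp: zero_less_mult_iff mult_less_0_iff)
    then show False
      using mono [of x y] x y by auto
  qed
  show "f c \<noteq> 0" if mono: "\<And>x y. a \<le> x \<Longrightarrow> x < y \<Longrightarrow> y \<le> b \<Longrightarrow> q x < q y"
  proof
    assume "f c = 0"
    then have "q x = 0" "q y = 0"
      using x y f vx vy c by auto
    then show False
      using mono [of x y] x y by auto
  qed
qed

lemma has_real_derivative_inner_left:
  assumes "(F has_vector_derivative F') (at t within S)"
  shows "((\<lambda>t. F t \<bullet> u) has_real_derivative F' \<bullet> u) (at t within S)"
  using bounded_linear.has_vector_derivative [OF bounded_linear_inner_left assms]
  by (simp add: has_real_derivative_iff_has_vector_derivative)

text \<open>Testing \<open>U\<close> against the fixed vector \<open>U y - U x\<close> reduces this mean value inequality to the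
  monotonicity of a real function.\<close>

lemma lipschitz_wrt_weight:
  fixes U W :: "real \<Rightarrow> 'a::real_inner" and s v :: "real \<Rightarrow> real"
  assumes U: "\<And>t. t \<in> {a..b} \<Longrightarrow> (U has_vector_derivative v t *\<^sub>R W t) (at t within {a..b})"
    and s: "\<And>t. t \<in> {a..b} \<Longrightarrow> (s has_real_derivative v t) (at t within {a..b})"
    and v: "\<And>t. t \<in> {a..b} \<Longrightarrow> v t > 0"
    and W: "\<And>t. t \<in> {a..b} \<Longrightarrow> norm (W t) \<le> c"
    and "a \<le> x" "x \<le> y" "y \<le> b"
  shows "norm (U y - U x) \<le> c * (s y - s x)"
proof -
  define e where "e = U y - U x"
  have "c * norm e * s x - U x \<bullet> e \<le> c * norm e * s y - U y \<bullet> e"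
  proof (rule nondecreasing_within [OF _ _ assms(5-7)])
    fix t assume t: "t \<in> {a..b}"
    show "((\<lambda>t. c * norm e * s t - U t \<bullet> e) has_real_derivative
        c * norm e * v t - (v t *\<^sub>R W t) \<bullet> e) (at t within {a..b})"
      by (rule derivative_eq_intros s U has_real_derivative_inner_left t refl | simp)+
    have "W t \<bullet> e \<le> c * norm e"
      using norm_cauchy_schwarz [of "W t" e] W [OF t]
      by (meson mult_right_mono norm_ge_zero order_trans)
    then have "v t * (W t \<bullet> e) \<le> v t * (c * norm e)"
      using v [OF t] by simp
    then show "0 \<le> c * norm e * v t - (v t *\<^sub>R W t) \<bullet> e"
      by (simp add: algebra_simps)
  qed
  then have "e \<bullet> e \<le> norm e * (c * (s y - s x))"
    unfolding e_def by (simp add: algebra_simps inner_diff_left inner_diff_right)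
  then have "norm e * norm e \<le> norm e * (c * (s y - s x))"
    by (simp add: dot_square_norm power2_eq_square)
  moreover have "0 \<le> c * (s y - s x)"
  proof -
    have "s x \<le> s y"
      using nondecreasing_within [OF s _ assms(5-7)] v by (simp add: less_imp_le)
    moreover have "0 \<le> c"
      using W [of x] assms(5-7) order_trans [OF norm_ge_zero] by auto
    ultimately show ?thesis by simp
  qed
  ultimately show ?thesis
    unfolding e_def [symmetric] by (cases "norm e = 0") auto
qed

section \<open>The geometry of an arc with constant curvature and torsion\<close>

text \<open>Arc length is \<open>s\<close>, and a derivative \<open>v t *\<^sub>R X\<close> means derivative \<open>X\<close> with respect to arc length.
  The differential equations are thus the Frenet equations with constant coefficients.\<close>

locale helix_arc =
  fixes a b \<kappa> \<tau> :: real and v s :: "real \<Rightarrow> real" and r T N B :: "real \<Rightarrow> real^3"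
  assumes ab: "a < b" and \<kappa>: "\<kappa> > 0" and \<tau>: "\<tau> > 0"
    and v: "t \<in> {a..b} \<Longrightarrow> v t > 0"
    and s: "t \<in> {a..b} \<Longrightarrow> (s has_real_derivative v t) (at t within {a..b})"
    and r: "t \<in> {a..b} \<Longrightarrow> (r has_vector_derivative v t *\<^sub>R T t) (at t within {a..b})"
    and T: "t \<in> {a..b} \<Longrightarrow> (T has_vector_derivative v t *\<^sub>R (\<kappa> *\<^sub>R N t)) (at t within {a..b})"
    and N: "t \<in> {a..b} \<Longrightarrow>
      (N has_vector_derivative v t *\<^sub>R (\<tau> *\<^sub>R B t - \<kappa> *\<^sub>R T t)) (at t within {a..b})"
    and B: "t \<in> {a..b} \<Longrightarrow> (B has_vector_derivative v t *\<^sub>R (- \<tau> *\<^sub>R N t)) (at t within {a..b})"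
    and norms: "t \<in> {a..b} \<Longrightarrow> norm (T t) = 1" "t \<in> {a..b} \<Longrightarrow> norm (N t) = 1"
      "t \<in> {a..b} \<Longrightarrow> norm (B t) = 1"
    and ortho: "t \<in> {a..b} \<Longrightarrow> T t \<bullet> B t = 0"
begin

text \<open>The angular velocity, per unit of arc length, of the rotating Frenet frame.\<close>

definition "\<omega> = sqrt (\<kappa>\<^sup>2 + \<tau>\<^sup>2)"

definition "len = s b - s a"

definition "chord = norm (r b - r a)"

text \<open>The Darboux vector, along the axis about which the Frenet frame rotates.\<close>

definition "axis_dir = \<tau> *\<^sub>R T a + \<kappa> *\<^sub>R B a"

lemma \<omega>_pos: "\<omega> > 0" and \<omega>_sq: "\<omega>\<^sup>2 = \<kappa>\<^sup>2 + \<tau>\<^sup>2"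
  using \<kappa> by (auto simp: \<omega>_def intro: add_pos_nonneg)

lemma s_less:
  assumes "a \<le> x" "x < y" "y \<le> b" shows "s x < s y"
proof -
  obtain z where z: "x < z" "z < y" "s y - s x = v z * (y - x)"
    using mean_value_within [OF s assms] by blast
  then have "v z * (y - x) > 0"
    using v [of z] assms by simp
  then show ?thesis
    using z by linarith
qed

lemma s_le: "a \<le> x \<Longrightarrow> x \<le> y \<Longrightarrow> y \<le> b \<Longrightarrow> s x \<le> s y"
  using s_less [of x y] by (cases "x = y") auto

lemma len_pos: "len > 0"
  using s_less [of a b] ab by (simp add: len_def)

lemma norm_combination:
  assumes "t \<in> {a..b}"
  shows "norm (x *\<^sub>R T t + y *\<^sub>R B t) = sqrt (x\<^sup>2 + y\<^sup>2)"
proof -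
  have "T t \<bullet> T t = 1" "B t \<bullet> B t = 1" "T t \<bullet> B t = 0" "B t \<bullet> T t = 0"
    using norms ortho assms by (simp_all add: dot_square_norm inner_commute)
  then show ?thesis
    by (simp add: norm_eq_sqrt_inner inner_add_left inner_add_right power2_eq_square)
qed

lemma axis_dir_eq:
  assumes "t \<in> {a..b}"
  shows "\<tau> *\<^sub>R T t + \<kappa> *\<^sub>R B t = axis_dir"
proof -
  have "((\<lambda>t. \<tau> *\<^sub>R T t + \<kappa> *\<^sub>R B t) has_vector_derivative 0) (at x within {a..b})"
    if "x \<in> {a..b}" for x
  proof -
    have "((\<lambda>t. \<tau> *\<^sub>R T t + \<kappa> *\<^sub>R B t) has_vector_derivative
        \<tau> *\<^sub>R v x *\<^sub>R \<kappa> *\<^sub>R N x + \<kappa> *\<^sub>R v x *\<^sub>R (- \<tau> *\<^sub>R N x)) (at x within {a..b})"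
      by (intro has_vector_derivative_add bounded_linear.has_vector_derivative
          [OF bounded_linear_scaleR_right] T B that)
    then show ?thesis
      by (simp add: mult.commute mult.left_commute)
  qed
  from has_vector_derivative_zero_constant [OF convex_real_interval(5) this]
  obtain c where "\<And>x. x \<in> {a..b} \<Longrightarrow> \<tau> *\<^sub>R T x + \<kappa> *\<^sub>R B x = c"
    by blast
  from this [OF assms] this [of a] show ?thesis
    using ab by (simp add: axis_dir_def)
qed

text \<open>The inner product of the tangent and the axis is constantly \<open>\<tau>\<close>.\<close>

lemma axis_progress:
  assumes "t \<in> {a..b}"
  shows "(r t - r a) \<bullet> axis_dir = \<tau> * (s t - s a)"
proof -
  have "((\<lambda>t. r t \<bullet> axis_dir - \<tau> * s t) has_vector_derivative 0) (at x within {a..b})"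
    if x: "x \<in> {a..b}" for x
  proof -
    have "T x \<bullet> axis_dir = \<tau>"
      unfolding axis_dir_eq [OF x, symmetric] inner_add_right inner_scaleR_right
      using norms ortho x by (simp add: dot_square_norm)
    moreover have "((\<lambda>t. r t \<bullet> axis_dir - \<tau> * s t) has_real_derivative
        (v x *\<^sub>R T x) \<bullet> axis_dir - \<tau> * v x) (at x within {a..b})"
      by (intro derivative_intros has_real_derivative_inner_left DERIV_cmult r s x)
    ultimately show ?thesis
      by (simp add: has_real_derivative_iff_has_vector_derivative mult.commute)
  qed
  from has_vector_derivative_zero_constant [OF convex_real_interval(5) this]
  obtain c where "\<And>x. x \<in> {a..b} \<Longrightarrow> r x \<bullet> axis_dir - \<tau> * s x = c"
    by blast
  from this [OF assms] this [of a] show ?thesis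
    using ab by (auto simp: inner_diff_left algebra_simps)
qed

lemma len_le_chord_axis: "\<tau> * len \<le> \<omega> * chord"
proof -
  have "norm axis_dir = \<omega>"
    using norm_combination [of a \<tau> \<kappa>] ab by (simp add: axis_dir_def \<omega>_def add.commute)
  then show ?thesis
    using axis_progress [of b] norm_cauchy_schwarz [of "r b - r a" axis_dir] ab
    by (simp add: len_def chord_def mult.commute)
qed

text \<open>The parameter that halves the arc by length. Comparing with the frame there, instead of at an
  end point, halves the bound for the angle by which the frame can have turned.\<close>

definition "mid = (SOME m. a \<le> m \<and> m \<le> b \<and> s m = (s a + s b) / 2)"

lemma mid: "a \<le> mid" "mid \<le> b" "s mid = (s a + s b) / 2"
proof -
  have "continuous_on {a..b} s"
    using s DERIV_continuous unfolding continuous_on_eq_continuous_within by blast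
  moreover have "s a \<le> (s a + s b) / 2" "(s a + s b) / 2 \<le> s b"
    using s_less [of a b] ab by auto
  ultimately have "\<exists>m. a \<le> m \<and> m \<le> b \<and> s m = (s a + s b) / 2"
    using ab by (intro IVT') auto
  from someI_ex [OF this] show "a \<le> mid" "mid \<le> b" "s mid = (s a + s b) / 2"
    by (auto simp: mid_def)
qed

text \<open>A unit vector that moves with speed at most \<open>\<omega>\<close> stays within distance \<open>\<omega> * \<bar>s t - s mid\<bar>\<close> of
  its middle position, and the inner product of unit vectors is determined by their distance.\<close>

lemma inner_mid_ge:
  assumes U: "\<And>t. t \<in> {a..b} \<Longrightarrow> (U has_vector_derivative v t *\<^sub>R W t) (at t within {a..b})"
    and unit: "\<And>t. t \<in> {a..b} \<Longrightarrow> norm (U t) = 1"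
    and W: "\<And>t. t \<in> {a..b} \<Longrightarrow> norm (W t) \<le> \<omega>"
    and t: "t \<in> {a..b}"
  shows "U t \<bullet> U mid \<ge> 1 - \<omega>\<^sup>2 * (s t - s mid)\<^sup>2 / 2"
proof -
  have "norm (U t - U mid) \<le> \<omega> * \<bar>s t - s mid\<bar>"
  proof (cases "mid \<le> t")
    case True
    then show ?thesis
      using lipschitz_wrt_weight [OF U s v W, of mid t] s_le [of mid t] t mid(1,2) by auto
  next
    case False
    then show ?thesis
      using lipschitz_wrt_weight [OF U s v W, of t mid] s_le [of t mid] t mid(1,2)
      by (auto simp: norm_minus_commute)
  qed
  then have "(norm (U t - U mid))\<^sup>2 \<le> \<omega>\<^sup>2 * (s t - s mid)\<^sup>2"
    by (metis norm_ge_zero power_mono power_mult_distrib power2_abs)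
  moreover have "(norm (U t - U mid))\<^sup>2 = 2 - 2 * (U t \<bullet> U mid)"
    using unit [OF t] unit [of mid] mid
    by (simp add: power2_norm_eq_inner norm_eq_1 inner_diff_left inner_diff_right inner_commute)
  ultimately show ?thesis
    by simp
qed

lemma normal_turn:
  assumes "t \<in> {a..b}"
  shows "N t \<bullet> N mid \<ge> 1 - \<omega>\<^sup>2 * len\<^sup>2 / 8"
proof -
  have "norm (\<tau> *\<^sub>R B t - \<kappa> *\<^sub>R T t) \<le> \<omega>" if "t \<in> {a..b}" for t
    using norm_combination [OF that, of "- \<kappa>" \<tau>] by (simp add: \<omega>_def)
  then have *: "N t \<bullet> N mid \<ge> 1 - \<omega>\<^sup>2 * (s t - s mid)\<^sup>2 / 2"
    by (intro inner_mid_ge [OF N]) (use norms assms in auto)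
  have "\<bar>s t - s mid\<bar> \<le> len / 2"
    using s_le [of a t] s_le [of t b] assms mid(3)
    by (auto simp: len_def abs_if field_simps)
  then have "(s t - s mid)\<^sup>2 \<le> (len / 2)\<^sup>2"
    by (metis abs_ge_zero power2_abs power_mono)
  then have "\<omega>\<^sup>2 * (s t - s mid)\<^sup>2 \<le> \<omega>\<^sup>2 * (len\<^sup>2 / 4)"
    by (intro mult_left_mono) (auto simp: power_divide)
  then show ?thesis
    using * by simp
qed

text \<open>Integrate the lower bound \<open>1 - \<omega>\<^sup>2 \<sigma>\<^sup>2 / 2\<close> for \<open>T t \<bullet> T mid\<close>, where \<open>\<sigma> = s t - s mid\<close> runs from
  \<open>- len / 2\<close> to \<open>len / 2\<close>: its primitive \<open>\<sigma> - \<omega>\<^sup>2 \<sigma> ^ 3 / 6\<close> grows no faster than \<open>r t \<bullet> T mid\<close>.\<close>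

lemma chord_ge: "chord \<ge> len * (1 - \<omega>\<^sup>2 * len\<^sup>2 / 24)"
proof -
  let ?f = "\<lambda>t. (r t \<bullet> T mid) - (s t - s mid) + \<omega>\<^sup>2 * (s t - s mid) ^ 3 / 6"
  have "?f a \<le> ?f b"
  proof (rule nondecreasing_within [where a = a and b = b and f = ?f and
        f' = "\<lambda>t. v t * (T t \<bullet> T mid - 1 + \<omega>\<^sup>2 * (s t - s mid)\<^sup>2 / 2)"])
    fix t assume t: "t \<in> {a..b}"
    have "((\<lambda>t. (r t \<bullet> T mid) - (s t - s mid) + \<omega>\<^sup>2 * (s t - s mid) ^ 3 / 6) has_real_derivative
        (v t *\<^sub>R T t) \<bullet> T mid - v t + \<omega>\<^sup>2 * (3 * (s t - s mid)\<^sup>2 * v t) / 6) (at t within {a..b})"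
      by (rule derivative_eq_intros has_real_derivative_inner_left r s t refl | simp)+
    then show "(?f has_real_derivative v t * (T t \<bullet> T mid - 1 + \<omega>\<^sup>2 * (s t - s mid)\<^sup>2 / 2))
        (at t within {a..b})"
      by (simp add: algebra_simps)
    have "norm (\<kappa> *\<^sub>R N t) \<le> \<omega>" if "t \<in> {a..b}" for t
      using norms(2) [OF that] \<kappa> by (simp add: \<omega>_def real_le_rsqrt)
    then have "T t \<bullet> T mid \<ge> 1 - \<omega>\<^sup>2 * (s t - s mid)\<^sup>2 / 2"
      by (intro inner_mid_ge [OF T]) (use norms t in auto)
    then show "0 \<le> v t * (T t \<bullet> T mid - 1 + \<omega>\<^sup>2 * (s t - s mid)\<^sup>2 / 2)"
      using v [OF t] by simp
  qed (use ab in auto)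
  moreover have sm: "s b - s mid = len / 2" "s a - s mid = - (len / 2)"
    using mid by (auto simp: len_def field_simps)
  ultimately have "len - \<omega>\<^sup>2 * len ^ 3 / 24 \<le> (r b - r a) \<bullet> T mid"
    unfolding sm by (simp add: inner_diff_left power_divide)
  also have "\<dots> \<le> chord"
    using norm_cauchy_schwarz [of "r b - r a" "T mid"] norms mid by (simp add: chord_def)
  finally show ?thesis
    by (simp add: algebra_simps power2_eq_square power3_eq_cube)
qed

text \<open>The point that divides the chord in the ratio in which \<open>r t\<close> divides the arc.\<close>

definition "chord_point t = r a + ((s t - s a) / len) *\<^sub>R (r b - r a)"

lemma chord_point_ends [simp]: "chord_point a = r a" "chord_point b = r b"
  using len_pos by (auto simp: chord_point_def len_def)

lemma deriv_offset:
  assumes "t \<in> {a..b}"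
  shows "((\<lambda>t. (r t - chord_point t) \<bullet> e) has_real_derivative
    v t * (T t \<bullet> e - (r b - r a) \<bullet> e / len)) (at t within {a..b})"
proof -
  define d where "d = (r b - r a) \<bullet> e"
  have "((\<lambda>t. r t \<bullet> e - r a \<bullet> e - (s t - s a) / len * d) has_real_derivative
      (v t *\<^sub>R T t) \<bullet> e - v t / len * d) (at t within {a..b})"
    using len_pos
    by (auto intro!: derivative_eq_intros has_real_derivative_inner_left r s assms)
  moreover have "(\<lambda>t. (r t - chord_point t) \<bullet> e) = (\<lambda>t. r t \<bullet> e - r a \<bullet> e - (s t - s a) / len * d)"
    unfolding chord_point_def d_def
    by (intro ext) (simp only: inner_diff_left inner_add_left inner_scaleR_left diff_diff_eq)
  ultimately show ?thesis
    unfolding d_def [symmetric] by (simp add: algebra_simps)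
qed

text \<open>The error estimate for linear interpolation in arc length, where \<open>\<kappa>\<close> bounds the second
  derivative. Along a fixed direction \<open>e\<close>, the error minus
  \<open>\<kappa> / 2 * norm e * (s t - s a) * (s b - s t)\<close> is a convex function of arc length that vanishes at
  both ends.\<close>

lemma dist_chord_point_le:
  assumes c: "a < c" "c < b"
  shows "norm (r c - chord_point c) \<le> \<kappa> * len\<^sup>2 / 8"
proof -
  define e where "e = r c - chord_point c"
  let ?k = "\<kappa> / 2 * norm e"
  let ?q = "\<lambda>t. T t \<bullet> e - (r b - r a) \<bullet> e / len + ?k * (2 * s t - s a - s b)"
  have "(r c - chord_point c) \<bullet> e - ?k * ((s c - s a) * (s b - s c)) \<le> 0"
  proof (rule convex_wrt_weight_nonpos
      [where f = "\<lambda>t. (r t - chord_point t) \<bullet> e - ?k * ((s t - s a) * (s b - s t))"])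
    fix t assume t: "t \<in> {a..b}"
    have "((\<lambda>t. (r t - chord_point t) \<bullet> e - ?k * ((s t - s a) * (s b - s t)))
        has_real_derivative v t * (T t \<bullet> e - (r b - r a) \<bullet> e / len)
          - ?k * ((s t - s a) * (- v t) + v t * (s b - s t))) (at t within {a..b})"
      by (rule derivative_eq_intros deriv_offset s t refl | simp)+
    then show "((\<lambda>t. (r t - chord_point t) \<bullet> e - ?k * ((s t - s a) * (s b - s t)))
        has_real_derivative v t * ?q t) (at t within {a..b})"
      by (rule DERIV_cong) (simp add: algebra_simps)
  next
    fix x y assume xy: "a \<le> x" "x < y" "y \<le> b"
    have "T x \<bullet> e + \<kappa> * norm e * s x \<le> T y \<bullet> e + \<kappa> * norm e * s y"
    proof -
      have "norm (T y - T x) \<le> \<kappa> * (s y - s x)"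
        by (rule lipschitz_wrt_weight [OF T s v]) (use xy norms \<kappa> in auto)
      then have "norm (T x - T y) * norm e \<le> \<kappa> * (s y - s x) * norm e"
        by (intro mult_right_mono) (auto simp: norm_minus_commute)
      with norm_cauchy_schwarz [of "T x - T y" e]
      have "(T x - T y) \<bullet> e \<le> \<kappa> * (s y - s x) * norm e"
        by (rule order_trans)
      then show ?thesis
        by (simp add: inner_diff_left algebra_simps)
    qed
    then show "?q x \<le> ?q y"
      by (simp add: algebra_simps)
  qed (use v c in auto)
  then have "norm e * norm e \<le> norm e * (\<kappa> / 2 * ((s c - s a) * (s b - s c)))"
    unfolding e_def [symmetric] by (simp add: dot_square_norm power2_eq_square mult_ac)
  moreover have "0 \<le> \<kappa> / 2 * ((s c - s a) * (s b - s c))"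
    using \<kappa> s_less [of a c] s_less [of c b] c by simp
  ultimately have "norm e \<le> \<kappa> / 2 * ((s c - s a) * (s b - s c))"
    by (cases "norm e = 0") auto
  also have "\<dots> \<le> \<kappa> / 2 * (len\<^sup>2 / 4)"
  proof -
    have "0 \<le> ((s c - s a) - (s b - s c))\<^sup>2"
      by simp
    then have "(s c - s a) * (s b - s c) \<le> len\<^sup>2 / 4"
      unfolding len_def by (simp add: power2_eq_square algebra_simps)
    then show ?thesis
      by (rule mult_left_mono) (use \<kappa> in simp)
  qed
  finally show ?thesis
    by (simp add: e_def)
qed

text \<open>In the direction of \<open>N mid\<close> the second derivative \<open>\<kappa> * (N t \<bullet> N mid)\<close> of the interpolation error
  is positive throughout a short arc, so the error cannot vanish between the ends.\<close>

lemma off_chord: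
  assumes short: "\<omega>\<^sup>2 * len\<^sup>2 < 8" and c: "a < c" "c < b"
  shows "r c \<noteq> chord_point c"
proof -
  have "(r c - chord_point c) \<bullet> N mid \<noteq> 0"
  proof (rule convex_wrt_weight_nonzero
      [where f = "\<lambda>t. (r t - chord_point t) \<bullet> N mid", OF deriv_offset])
    fix x y assume xy: "a \<le> x" "x < y" "y \<le> b"
    have "T x \<bullet> N mid < T y \<bullet> N mid"
    proof -
      have "((\<lambda>t. T t \<bullet> N mid) has_real_derivative (v t *\<^sub>R \<kappa> *\<^sub>R N t) \<bullet> N mid) (at t within {a..b})"
        if "t \<in> {a..b}" for t
        by (intro has_real_derivative_inner_left T that)
      from mean_value_within [OF this xy] obtain z where z: "x < z" "z < y"
        "T y \<bullet> N mid - T x \<bullet> N mid = (v z *\<^sub>R \<kappa> *\<^sub>R N z) \<bullet> N mid * (y - x)"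
        by blast
      have "N z \<bullet> N mid > 0"
        using normal_turn [of z] short z xy by auto
      then have "(v z *\<^sub>R \<kappa> *\<^sub>R N z) \<bullet> N mid * (y - x) > 0"
        using v [of z] \<kappa> z xy by simp
      then show ?thesis
        using z by linarith
    qed
    then show "T x \<bullet> N mid - (r b - r a) \<bullet> N mid / len < T y \<bullet> N mid - (r b - r a) \<bullet> N mid / len"
      by simp
  qed (use v c in auto)
  then show ?thesis
    by auto
qed

text \<open>Sliding a vertex parallel to the base keeps the area of a triangle, so \<open>r c - r a\<close> may be replaced
  by the difference of \<open>r c\<close> and a point of the chord.\<close>

lemma norm_cross_le:
  assumes "a < c" "c < b"
  shows "norm (cross3 (r c - r a) (r b - r a)) \<le> \<kappa> * len\<^sup>2 / 8 * chord"
proof -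
  define d where "d = r b - r a"
  have "r c - r a = (r c - chord_point c) + ((s c - s a) / len) *\<^sub>R d"
    by (simp add: chord_point_def d_def)
  then have "cross3 (r c - r a) d = cross3 (r c - chord_point c) d"
    by (simp only: cross_add_left cross_mult_left cross_refl scaleR_zero_right add_0_right)
  then have "cross3 (r c - r a) (r b - r a) = cross3 (r c - chord_point c) (r b - r a)"
    by (simp only: d_def)
  moreover have "norm (cross3 x y) \<le> norm x * norm y" for x y :: "real^3"
  proof (rule power2_le_imp_le)
    show "(norm (cross3 x y))\<^sup>2 \<le> (norm x * norm y)\<^sup>2"
      unfolding norm_cross_dot [symmetric] by simp
  qed simp
  ultimately have "norm (cross3 (r c - r a) (r b - r a)) \<le> norm (r c - chord_point c) * chord"
    by (simp add: chord_def)
  also have "\<dots> \<le> \<kappa> * len\<^sup>2 / 8 * chord"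
    using dist_chord_point_le [OF assms] by (intro mult_right_mono) (auto simp: chord_def)
  finally show ?thesis .
qed

text \<open>If \<open>r c\<close> were on the line of the chord, its progress along the axis would identify it with
  \<open>chord_point c\<close>.\<close>

lemma cross_nonzero:
  assumes short: "\<omega>\<^sup>2 * len\<^sup>2 < 8" and c: "a < c" "c < b"
  shows "cross3 (r c - r a) (r b - r a) \<noteq> 0"
proof
  assume "cross3 (r c - r a) (r b - r a) = 0"
  then have "collinear {0, r b - r a, r c - r a}"
    by (simp add: cross_eq_0 insert_commute)
  moreover have "r b - r a \<noteq> 0"
    using axis_progress [of b] \<tau> len_pos ab by (auto simp: len_def)
  ultimately obtain l where l: "r c - r a = l *\<^sub>R (r b - r a)"
    unfolding collinear_lemma by auto
  have "\<tau> * (s c - s a) = (r c - r a) \<bullet> axis_dir"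
    using axis_progress [of c] c by simp
  also have "\<dots> = l * ((r b - r a) \<bullet> axis_dir)"
    by (simp only: l inner_scaleR_left)
  also have "\<dots> = l * (\<tau> * len)"
    using axis_progress [of b] ab by (simp add: len_def)
  finally have "\<tau> * (s c - s a) = \<tau> * (l * len)"
    by simp
  then have "s c - s a = l * len"
    using \<tau> by (metis mult_left_cancel less_irrefl)
  then have "l = (s c - s a) / len"
    using len_pos by simp
  then have "r c = chord_point c"
    using l by (simp add: chord_point_def algebra_simps)
  then show False
    using off_chord [OF short c] by simp
qed

text \<open>The lower bound \<open>1\<close> for the area of a lattice parallelogram contradicts the upper bound
  \<open>9/32 * (k * chord) ^ 3\<close> with \<open>k = \<kappa> powr (1/3)\<close>. The first hypothesis gives
  \<open>\<omega> * len < 1.1 / 0.4 = 2.75\<close>, and \<open>2.75\<^sup>2 < 8\<close> makes the arc short enough for both the chord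
  estimate and non-collinearity.\<close>

lemma lattice_points_spread:
  assumes pitch: "\<tau> * \<kappa> powr (1/3) \<ge> 0.4 * (\<kappa>\<^sup>2 + \<tau>\<^sup>2)"
    and c: "a < c" "c < b"
    and lattice: "lattice_point (r a)" "lattice_point (r c)" "lattice_point (r b)"
  shows "chord \<ge> 1.1 * \<kappa> powr (-1/3)"
proof (rule ccontr)
  define k where "k = \<kappa> powr (1/3)"
  have k: "k > 0" "\<kappa> = k ^ 3"
    using \<kappa> by (auto simp: k_def powr_powr simp flip: powr_realpow)
  assume "\<not> chord \<ge> 1.1 * \<kappa> powr (-1/3)"
  then have "k * chord < 1.1"
    using k(1) by (simp add: k_def powr_minus field_simps)
  have chord_nonneg: "chord \<ge> 0"
    by (simp add: chord_def)
  have "0.4 * (\<omega> * len) < 1.1"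
  proof -
    have "\<tau> * (0.4 * \<omega> * len) = 0.4 * \<omega> * (\<tau> * len)"
      by simp
    also have "\<dots> \<le> 0.4 * \<omega> * (\<omega> * chord)"
      using len_le_chord_axis \<omega>_pos by (intro mult_left_mono) auto
    also have "\<dots> = 0.4 * \<omega>\<^sup>2 * chord"
      by (simp add: power2_eq_square)
    also have "\<dots> \<le> \<tau> * k * chord"
      using pitch chord_nonneg by (intro mult_right_mono) (auto simp: \<omega>_sq k_def)
    also have "\<dots> < \<tau> * 1.1"
      using \<open>k * chord < 1.1\<close> \<tau> by simp
    finally show ?thesis
      using \<tau> by (simp add: mult.assoc)
  qed
  then have "(\<omega> * len)\<^sup>2 < 2.75\<^sup>2"
    using \<omega>_pos len_pos by (intro power_strict_mono) auto
  also have "(2.75 :: real)\<^sup>2 < 8"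
    by (simp add: power2_eq_square)
  finally have short: "\<omega>\<^sup>2 * len\<^sup>2 < 8"
    by (simp only: power_mult_distrib)
  \<comment> \<open>The bound \<open>8\<close> leaves the factor \<open>1 - 8 / 24 = 2 / 3\<close>.\<close>
  have "2 / 3 * len \<le> len * (1 - \<omega>\<^sup>2 * len\<^sup>2 / 24)"
    using short len_pos by (simp add: mult.commute)
  also note chord_ge
  finally have "len \<le> 3 / 2 * chord"
    by simp
  then have "len\<^sup>2 \<le> (3 / 2 * chord)\<^sup>2"
    using len_pos by (intro power_mono) auto
  then have "\<kappa> * len\<^sup>2 / 8 * chord \<le> \<kappa> * (3 / 2 * chord)\<^sup>2 / 8 * chord"
    using \<kappa> chord_nonneg by (intro mult_right_mono divide_right_mono mult_left_mono) auto
  also have "\<dots> = 9 / 32 * (k * chord) ^ 3"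
    by (simp add: k(2) power_mult_distrib power2_eq_square power3_eq_cube)
  also have "\<dots> \<le> 9 / 32 * 1.1 ^ 3"
    using \<open>k * chord < 1.1\<close> k chord_nonneg by (intro mult_left_mono power_mono) auto
  also have "\<dots> < 1"
    by (simp add: power3_eq_cube)
  finally have "norm (cross3 (r c - r a) (r b - r a)) < 1"
    using norm_cross_le [OF c] by linarith
  moreover have "norm (cross3 (r c - r a) (r b - r a)) \<ge> 1"
    using norm_cross_lattice_ge_1 [OF lattice cross_nonzero [OF short c]] .
  ultimately show False
    by simp
qed

end

section \<open>The Frenet frame of a curve with constant curvature and torsion\<close>

text \<open>TODO\<close>

lemma has_vector_derivative_cross3:
  assumes "(f has_vector_derivative f') (at t within S)" "(g has_vector_derivative g') (at t within S)"
  shows "((\<lambda>t. cross3 (f t) (g t)) has_vector_derivative cross3 (f t) g' + cross3 f' (g t)) (at t within S)"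
  using bounded_bilinear.has_vector_derivative [OF _ assms] bilinear_cross
    bilinear_conv_bounded_bilinear by blast

text \<open>By the Lagrange identity \<open>x \<times> (B \<times> T) = 0\<close>, and \<open>B \<times> T\<close> has norm \<open>1\<close>.\<close>

lemma eq_component_normal:
  fixes x T B :: "real^3"
  assumes "norm T = 1" "norm B = 1" "T \<bullet> B = 0" "x \<bullet> T = 0" "x \<bullet> B = 0"
  shows "x = (x \<bullet> cross3 B T) *\<^sub>R cross3 B T"
proof -
  have n: "cross3 B T \<bullet> cross3 B T = 1"
    using norm_cross_dot [of B T] assms by (simp add: inner_commute power2_norm_eq_inner)
  have "cross3 x (cross3 B T) = 0"
    unfolding Lagrange [of x] using assms by simp
  then have "cross3 (cross3 B T) (cross3 x (cross3 B T)) = 0"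
    by simp
  then show ?thesis
    using n unfolding Lagrange [of "cross3 B T"] by (simp add: inner_commute)
qed

text \<open>With \<open>T = r1 / v\<close>, the part of \<open>r2\<close> orthogonal to \<open>T\<close> is \<open>v\<^sup>2 \<kappa> N\<close>, which gives \<open>T' = v \<kappa> N\<close>. Since
  \<open>B\<close> is a multiple of \<open>r1 \<times> r2\<close>, the derivative \<open>B'\<close> is a combination of \<open>r1 \<times> r2\<close> and \<open>r1 \<times> r3\<close>,
  hence orthogonal to \<open>T\<close>; it is orthogonal to \<open>B\<close> because \<open>norm B = 1\<close>, and the torsion determines
  its component along \<open>N\<close>. The equation for \<open>N = B \<times> T\<close> follows by the product rule.\<close>

lemma frenet_frame:
  fixes r r1 r2 r3 :: "real \<Rightarrow> real^3"
  assumes ab: "a < b" and \<kappa>: "\<kappa> > 0" and \<tau>: "\<tau> > 0"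
    and r: "\<And>t. t \<in> {a..b} \<Longrightarrow> (r has_vector_derivative r1 t) (at t within {a..b})"
    and r1: "\<And>t. t \<in> {a..b} \<Longrightarrow> (r1 has_vector_derivative r2 t) (at t within {a..b})"
    and r2: "\<And>t. t \<in> {a..b} \<Longrightarrow> (r2 has_vector_derivative r3 t) (at t within {a..b})"
    and regular: "\<And>t. t \<in> {a..b} \<Longrightarrow> r1 t \<noteq> 0"
    and curv: "\<And>t. t \<in> {a..b} \<Longrightarrow> norm (cross3 (r1 t) (r2 t)) / norm (r1 t) ^ 3 = \<kappa>"
    and tors: "\<And>t. t \<in> {a..b} \<Longrightarrow>
      (cross3 (r1 t) (r2 t) \<bullet> r3 t) / norm (cross3 (r1 t) (r2 t)) ^ 2 = \<tau>"
  obtains v s T N B where "helix_arc a b \<kappa> \<tau> v s r T N B"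
proof -
  define v where "v t = norm (r1 t)" for t
  define s where "s t = integral {a..t} v" for t
  define T where "T t = inverse (v t) *\<^sub>R r1 t" for t
  define B where "B t = inverse (\<kappa> * v t ^ 3) *\<^sub>R cross3 (r1 t) (r2 t)" for t
  define N where "N t = cross3 (B t) (T t)" for t
  have v_pos: "v t > 0" if "t \<in> {a..b}" for t
    using regular [OF that] by (simp add: v_def)
  have r1_sq: "r1 t \<bullet> r1 t = (v t)\<^sup>2" for t
    by (simp add: v_def dot_square_norm)
  have r1_eq: "r1 t = v t *\<^sub>R T t" if "t \<in> {a..b}" for t
    using v_pos [OF that] by (simp add: T_def)
  have norm_cross: "norm (cross3 (r1 t) (r2 t)) = \<kappa> * v t ^ 3" if "t \<in> {a..b}" for t
    using curv [OF that] v_pos [OF that] by (simp add: v_def field_simps)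
  have cont_v: "continuous_on {a..b} v"
    unfolding v_def continuous_on_eq_continuous_within
    using r1 has_vector_derivative_continuous continuous_norm by blast
  have nT: "norm (T t) = 1" and nB: "norm (B t) = 1" and TB: "T t \<bullet> B t = 0"
    and nN: "norm (N t) = 1" if t: "t \<in> {a..b}" for t
  proof -
    have pos: "\<kappa> * v t ^ 3 > 0"
      using v_pos [OF t] \<kappa> by simp
    have "norm (T t) = inverse (v t) * v t"
      using v_pos [OF t] by (simp add: T_def v_def)
    moreover have "norm (B t) = inverse (\<kappa> * v t ^ 3) * (\<kappa> * v t ^ 3)"
      unfolding B_def norm_scaleR norm_cross [OF t] by (simp only: abs_inverse abs_of_pos [OF pos])
    moreover have "T t \<bullet> B t = 0"
      by (simp add: T_def B_def dot_cross_self)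
    moreover have "inverse (v t) * v t = 1" "inverse (\<kappa> * v t ^ 3) * (\<kappa> * v t ^ 3) = 1"
      using v_pos [OF t] pos less_irrefl left_inverse by metis+
    ultimately show *: "norm (T t) = 1" "norm (B t) = 1" "T t \<bullet> B t = 0"
      by (simp_all only:)
    have "B t \<bullet> T t = 0"
      using * by (simp only: inner_commute)
    then have "(norm (N t))\<^sup>2 = 1"
      using norm_cross_dot [of "B t" "T t"] * by (simp add: N_def)
    then show "norm (N t) = 1"
      by (simp only: abs_square_eq_1 abs_norm_cancel)
  qed
  have dv: "(v has_real_derivative (r1 t \<bullet> r2 t) / v t) (at t within {a..b})" if t: "t \<in> {a..b}" for t
  proof -
    have "((\<lambda>t. norm (r1 t)) has_derivative (\<lambda>h. (h *\<^sub>R r2 t) \<bullet> sgn (r1 t))) (at t within {a..b})"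
      using has_derivative_compose [OF r1 [OF t, unfolded has_vector_derivative_def]
        has_derivative_norm [OF regular [OF t]]] by (simp add: o_def)
    then show ?thesis
      unfolding has_field_derivative_def v_def
      by (rule has_derivative_eq_rhs) (auto simp: sgn_div_norm inner_commute divide_inverse)
  qed
  have vN: "v t *\<^sub>R (\<kappa> *\<^sub>R N t) = inverse (v t) *\<^sub>R r2 t
      + - (inverse (v t) * ((r1 t \<bullet> r2 t) / v t) * inverse (v t)) *\<^sub>R r1 t" if t: "t \<in> {a..b}" for t
  proof -
    have "N t = - cross3 (T t) (B t)"
      by (simp add: N_def cross_skew [of "B t" "T t"])
    also have "cross3 (T t) (B t) = (inverse (v t) * inverse (\<kappa> * v t ^ 3)) *\<^sub>R
        ((r1 t \<bullet> r2 t) *\<^sub>R r1 t - (v t)\<^sup>2 *\<^sub>R r2 t)"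
      by (simp add: T_def B_def cross_mult_left cross_mult_right Lagrange r1_sq
          scaleR_right_diff_distrib mult_ac)
    finally have N_eq: "N t = - ((inverse (v t) * inverse (\<kappa> * v t ^ 3)) *\<^sub>R
        ((r1 t \<bullet> r2 t) *\<^sub>R r1 t - (v t)\<^sup>2 *\<^sub>R r2 t))" .
    define c where "c = v t * (\<kappa> * (inverse (v t) * inverse (\<kappa> * v t ^ 3)))"
    have "v t *\<^sub>R (\<kappa> *\<^sub>R N t) = c *\<^sub>R ((v t)\<^sup>2 *\<^sub>R r2 t - (r1 t \<bullet> r2 t) *\<^sub>R r1 t)"
      unfolding N_eq c_def scaleR_scaleR [symmetric]
      by (simp only: scaleR_minus_right [symmetric] minus_diff_eq)
    also have "\<dots> = (c * (v t)\<^sup>2) *\<^sub>R r2 t + - (c * (r1 t \<bullet> r2 t)) *\<^sub>R r1 t"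
      by (simp add: scaleR_right_diff_distrib)
    also have "c * (v t)\<^sup>2 = inverse (v t)"
      using v_pos [OF t] \<kappa> by (simp add: c_def field_simps power2_eq_square power3_eq_cube)
    also have "c * (r1 t \<bullet> r2 t) = inverse (v t) * ((r1 t \<bullet> r2 t) / v t) * inverse (v t)"
      using v_pos [OF t] \<kappa> by (simp add: c_def field_simps power3_eq_cube)
    finally show ?thesis .
  qed
  have dT: "(T has_vector_derivative v t *\<^sub>R (\<kappa> *\<^sub>R N t)) (at t within {a..b})" if t: "t \<in> {a..b}" for t
  proof -
    have "(T has_vector_derivative inverse (v t) *\<^sub>R r2 t
        + - (inverse (v t) * ((r1 t \<bullet> r2 t) / v t) * inverse (v t)) *\<^sub>R r1 t) (at t within {a..b})"
      unfolding T_def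
      by (intro has_vector_derivative_scaleR DERIV_inverse' dv r1 t) (use v_pos [OF t] in auto)
    then show ?thesis
      by (simp only: vN [OF t])
  qed
  have dB: "(B has_vector_derivative v t *\<^sub>R (- \<tau> *\<^sub>R N t)) (at t within {a..b})" if t: "t \<in> {a..b}" for t
  proof -
    define c where "c t = inverse (\<kappa> * v t ^ 3)" for t
    have nonzero: "\<kappa> * v t ^ 3 \<noteq> 0"
      using v_pos [OF t] \<kappa> by simp
    obtain c' where c': "(c has_real_derivative c') (at t within {a..b})"
      unfolding c_def
      using DERIV_inverse' [OF DERIV_cmult [OF DERIV_power [OF dv [OF t], of 3], of \<kappa>] nonzero]
      by blast
    define B' where "B' = c t *\<^sub>R cross3 (r1 t) (r3 t) + c' *\<^sub>R cross3 (r1 t) (r2 t)"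
    have "((\<lambda>t. c t *\<^sub>R cross3 (r1 t) (r2 t)) has_vector_derivative
        c t *\<^sub>R (cross3 (r1 t) (r3 t) + cross3 (r2 t) (r2 t)) + c' *\<^sub>R cross3 (r1 t) (r2 t)) (at t within {a..b})"
      by (intro has_vector_derivative_scaleR has_vector_derivative_cross3 c' r1 r2 t)
    \<comment> \<open>The term \<open>r2 t \<times> r2 t\<close> of the product rule vanishes.\<close>
    then have B': "(B has_vector_derivative B') (at t within {a..b})"
      by (simp add: B'_def B_def [abs_def] c_def)
    have B'T: "B' \<bullet> r1 t = 0"
      by (simp add: B'_def inner_add_left dot_cross_self)
    have B'B: "B' \<bullet> B t = 0"
    proof -
      have "((\<lambda>t. B t \<bullet> B t) has_vector_derivative B t \<bullet> B' + B' \<bullet> B t) (at t within {a..b})"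
        by (rule bounded_bilinear.has_vector_derivative [OF bounded_bilinear_inner B' B'])
      moreover have "((\<lambda>t. B t \<bullet> B t) has_vector_derivative 0) (at t within {a..b})"
        by (rule has_vector_derivative_transform [OF t _ has_vector_derivative_const [of 1]])
          (simp add: nB flip: norm_eq_1)
      ultimately have "B t \<bullet> B' + B' \<bullet> B t = 0"
        using vector_derivative_unique_within_closed_interval [OF ab] t by simp
      then show ?thesis
        by (simp add: inner_commute)
    qed
    have B'N: "B' \<bullet> N t = - (v t * \<tau>)"
    proof -
      have "B' \<bullet> r2 t = - (c t * (cross3 (r1 t) (r2 t) \<bullet> r3 t))"
        using cross_triple [of "r1 t" "r3 t" "r2 t"] cross_triple [of "r1 t" "r2 t" "r3 t"]
          cross_skew [of "r3 t" "r2 t"]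
        by (simp add: B'_def inner_add_left dot_cross_self)
      also have "cross3 (r1 t) (r2 t) \<bullet> r3 t = \<tau> * (\<kappa> * v t ^ 3)\<^sup>2"
        using tors [OF t] norm_cross [OF t] v_pos [OF t] \<kappa> by (simp add: field_simps)
      also have "c t * \<dots> = \<tau> * (\<kappa> * v t ^ 3) * (c t * (\<kappa> * v t ^ 3))"
        by algebra
      also have "c t * (\<kappa> * v t ^ 3) = 1"
        unfolding c_def by (rule left_inverse [OF nonzero])
      finally have "B' \<bullet> r2 t = - (\<tau> * \<kappa> * v t ^ 3)"
        by simp
      moreover have "B' \<bullet> r2 t = \<kappa> * (v t)\<^sup>2 * (B' \<bullet> N t)"
      proof -
        have *: "v t * (\<kappa> * (B' \<bullet> N t)) = inverse (v t) * (B' \<bullet> r2 t)"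
          using arg_cong [OF vN [OF t], of "\<lambda>x. B' \<bullet> x"] B'T
          by (simp only: inner_add_right inner_scaleR_right mult_zero_right add_0_right)
        have "B' \<bullet> r2 t = v t * (inverse (v t) * (B' \<bullet> r2 t))"
          using v_pos [OF t] by simp
        also have "\<dots> = \<kappa> * (v t)\<^sup>2 * (B' \<bullet> N t)"
          unfolding * [symmetric] by (simp add: power2_eq_square)
        finally show ?thesis .
      qed
      ultimately have "\<kappa> * (v t)\<^sup>2 * (B' \<bullet> N t) = \<kappa> * (v t)\<^sup>2 * - (v t * \<tau>)"
        by (simp add: power2_eq_square power3_eq_cube)
      moreover have "\<kappa> * (v t)\<^sup>2 \<noteq> 0"
        using v_pos [OF t] \<kappa> by simp
      ultimately show ?thesis
        by (metis mult_left_cancel)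
    qed
    have "B' \<bullet> T t = 0"
      using B'T by (simp add: T_def)
    then have "B' = (B' \<bullet> N t) *\<^sub>R N t"
      unfolding N_def by (rule eq_component_normal [OF nT [OF t] nB [OF t] TB [OF t] _ B'B])
    also have "\<dots> = v t *\<^sub>R (- \<tau> *\<^sub>R N t)"
      by (simp add: B'N)
    finally show ?thesis
      using B' by (simp only:)
  qed
  have dN: "(N has_vector_derivative v t *\<^sub>R (\<tau> *\<^sub>R B t - \<kappa> *\<^sub>R T t)) (at t within {a..b})"
    if t: "t \<in> {a..b}" for t
  proof -
    have "(N has_vector_derivative cross3 (B t) (v t *\<^sub>R (\<kappa> *\<^sub>R N t))
        + cross3 (v t *\<^sub>R (- \<tau> *\<^sub>R N t)) (T t)) (at t within {a..b})"
      unfolding N_def [abs_def] using dT dB t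
      by (intro has_vector_derivative_cross3) (simp_all add: N_def)
    moreover have "cross3 (B t) (N t) = - T t" "cross3 (N t) (T t) = - B t"
      using nT [OF t] nB [OF t] TB [OF t] cross_skew [of "N t" "T t"]
      by (simp_all add: N_def Lagrange inner_commute dot_square_norm)
    ultimately show ?thesis
      by (simp add: cross_mult_left cross_mult_right algebra_simps)
  qed
  have "helix_arc a b \<kappa> \<tau> v s r T N B"
  proof
    show "(s has_real_derivative v t) (at t within {a..b})" if "t \<in> {a..b}" for t
      unfolding s_def using integral_has_real_derivative [OF cont_v that] .
    show "(r has_vector_derivative v t *\<^sub>R T t) (at t within {a..b})" if "t \<in> {a..b}" for t
      using r [OF that] r1_eq [OF that] by simp
  qed (use ab \<kappa> \<tau> v_pos dT dN dB nT nN nB TB in auto)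
  then show ?thesis
    by (rule that)
qed

lemma curve_deriv_within:
  assumes I: "is_interval I" "a \<in> I" "b \<in> I" "a < b"
    and f: "f differentiable_on I" and t: "t \<in> {a..b}"
  shows "(f has_vector_derivative curve_deriv I f t) (at t within {a..b})"
proof -
  have sub: "{a..b} \<subseteq> I"
    using mem_is_interval_1_I [OF I(1-3)] by auto
  then have "(f has_vector_derivative curve_deriv I f t) (at t within I)"
    using f t unfolding curve_deriv_def differentiable_on_def
    by (meson subsetD vector_derivative_works)
  then show ?thesis
    using sub by (rule has_vector_derivative_within_subset)
qed

lemma lattice_points_on_arc:
  assumes \<kappa>: "\<kappa> > 0" and \<tau>: "\<tau> > 0"
    and pitch: "\<tau> * \<kappa> powr (1/3) \<ge> 0.4 * (\<kappa>\<^sup>2 + \<tau>\<^sup>2)"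
    and curve: "regular_C3_curve I r"
    and const: "\<And>t. t \<in> I \<Longrightarrow> curvature I r t = \<kappa> \<and> torsion I r t = \<tau>"
    and abc: "a \<in> I" "b \<in> I" "a < c" "c < b"
    and lattice: "lattice_point (r a)" "lattice_point (r c)" "lattice_point (r b)"
  shows "dist (r a) (r b) \<ge> 1.1 * \<kappa> powr (-1/3)"
proof -
  have ab: "a < b"
    using abc by simp
  have I: "is_interval I"
    using curve by (simp add: regular_C3_curve_def)
  then have sub: "t \<in> I" if "t \<in> {a..b}" for t
    using mem_is_interval_1_I [OF _ abc(1,2)] that by auto
  note D = curve_deriv_within [OF I abc(1,2) ab]
  obtain v s T N B where "helix_arc a b \<kappa> \<tau> v s r T N B"
  proof (rule frenet_frame [OF ab \<kappa> \<tau>])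
    fix t assume t: "t \<in> {a..b}"
    show "(r has_vector_derivative curve_deriv I r t) (at t within {a..b})"
      using curve t by (intro D) (auto simp: regular_C3_curve_def)
    show "(curve_deriv I r has_vector_derivative (curve_deriv I ^^ 2) r t) (at t within {a..b})"
      using curve t D [of "curve_deriv I r" t] by (auto simp: regular_C3_curve_def eval_nat_numeral)
    show "((curve_deriv I ^^ 2) r has_vector_derivative (curve_deriv I ^^ 3) r t) (at t within {a..b})"
      using curve t D [of "(curve_deriv I ^^ 2) r" t] by (auto simp: regular_C3_curve_def eval_nat_numeral)
    show "curve_deriv I r t \<noteq> 0"
      using curve sub [OF t] by (auto simp: regular_C3_curve_def)
  qed (use const sub in \<open>auto simp: curvature_def torsion_def\<close>)
  then interpret helix_arc a b \<kappa> \<tau> v s r T N B .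
  show ?thesis
    using lattice_points_spread [OF pitch abc(3,4) lattice] by (simp add: chord_def dist_norm norm_minus_commute)
qed

theorem corollary4:
  fixes \<kappa> \<tau> :: real and H :: "(real^3) set" and A\<^sub>0 A\<^sub>1 A\<^sub>2 :: "real^3"
  assumes "\<kappa> > 0" and "\<tau> > 0"
    and "is_helix \<kappa> \<tau> H"
    and "\<tau> * \<kappa> powr (1/3) \<ge> 0.4 * (\<kappa>\<^sup>2 + \<tau>\<^sup>2)"
    and "A\<^sub>0 \<in> H" and "A\<^sub>1 \<in> H" and "A\<^sub>2 \<in> H"
    and "lattice_point A\<^sub>0" and "lattice_point A\<^sub>1" and "lattice_point A\<^sub>2"
    and "A\<^sub>0 \<noteq> A\<^sub>1" and "A\<^sub>1 \<noteq> A\<^sub>2" and "A\<^sub>0 \<noteq> A\<^sub>2"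
  shows "Max {dist A\<^sub>0 A\<^sub>1, dist A\<^sub>1 A\<^sub>2, dist A\<^sub>0 A\<^sub>2} \<ge> 1.1 * \<kappa> powr (-1/3)"
proof -
  obtain I r where curve: "regular_C3_curve I r" "H = r ` I"
    and const: "\<And>t. t \<in> I \<Longrightarrow> curvature I r t = \<kappa> \<and> torsion I r t = \<tau>"
    using assms(3) unfolding is_helix_def by blast
  obtain x y z where I: "x \<in> I" "y \<in> I" "z \<in> I" and A: "A\<^sub>0 = r x" "A\<^sub>1 = r y" "A\<^sub>2 = r z"
    using assms(5-7) curve(2) by blast
  have distinct: "x \<noteq> y" "y \<noteq> z" "x \<noteq> z"
    using assms(11-13) A by auto
  note spread = lattice_points_on_arc [OF assms(1,2,4) curve(1) const]
  \<comment> \<open>Whichever of the parameters lies in the middle, the points of the outer two are far apart.\<close>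
  consider "x < y" "y < z" | "z < y" "y < x" | "x < z" "z < y" | "y < z" "z < x" |
    "y < x" "x < z" | "z < x" "x < y"
    using distinct by linarith
  then have "1.1 * \<kappa> powr (-1/3) \<le> dist A\<^sub>0 A\<^sub>1 \<or> 1.1 * \<kappa> powr (-1/3) \<le> dist A\<^sub>1 A\<^sub>2 \<or>
      1.1 * \<kappa> powr (-1/3) \<le> dist A\<^sub>0 A\<^sub>2"
  proof cases
    case 1
    with spread [of x z y] I assms(8-10) show ?thesis by (simp add: A)
  next
    case 2
    with spread [of z x y] I assms(8-10) show ?thesis by (simp add: A dist_commute)
  next
    case 3
    with spread [of x y z] I assms(8-10) show ?thesis by (simp add: A)
  next
    case 4
    with spread [of y x z] I assms(8-10) show ?thesis by (simp add: A dist_commute)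
  next
    case 5
    with spread [of y z x] I assms(8-10) show ?thesis by (simp add: A)
  next
    case 6
    with spread [of z y x] I assms(8-10) show ?thesis by (simp add: A dist_commute)
  qed
  then show ?thesis
    by (simp add: le_max_iff_disj)
qed

end
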